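(* Let $\mathscr{A}$ be a unital $C^*$-algebra and $\mathscr{I}\subseteq\mathscr{A}$ a left ideal. A linear functional $g_0:\mathscr{I}\to\mathbb{C}$ possesses a continuous hermitian extension $g:\mathscr{A}\to\mathbb{C}$ if and only if $g_0$ is symmetric and $f$-bounded for some positive functional $f\in\mathscr{A}^*$.
   Context: A linear functional $f$ on $\mathscr{A}$ is positive if $f(x^*x)\ge0$ for all $x\in\mathscr{A}$. A linear functional $g:\mathscr{I}\to\mathbb{C}$ on a (not necessarily closed) left ideal $\mathscr{I}$ is symmetric if $g(b^*a)=\overline{g(a^*b)}$ for all $a,b\in\mathscr{I}$. A linear functional $g$ on $\mathscr{A}$ is hermitian if $g(x^* )=\overline{g(x)}$ for all $x\in\mathscr{A}$. Given a positive functional $f$ on $\mathscr{A}$, a symmetric functional $g:\mathscr{I}\to\mathbb{C}$ is $f$-bounded if there is a constant $\alpha>0$ such that $$|g(x^*a)|^2\le\alpha^2 f(x^*x)f(a^*a),\qquad x\in\mathscr{A},\ a\in\mathscr{I}.$$ *)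

theory Defs
  imports "HOL-Analysis.Analysis"
begin

text \<open>
  Unital \<open>C\<^sup>*\<close>-algebras over the complex numbers. The multiplicative unit comes from
  \<^class>\<open>monoid_mult\<close> rather than from \<^class>\<open>real_normed_algebra_1\<close>, whose axioms include
  \<open>0 \<noteq> 1\<close> and would exclude the zero algebra; \<open>norm 1 = 1\<close> for a nonzero algebra follows
  from the \<open>C\<^sup>*\<close>-identity. The axiom \<open>scaleR_scaleC\<close> ties the complex scalar multiplication
  to the real one of the underlying Banach algebra.
\<close>

class scaleC =
  fixes scaleC :: "complex \<Rightarrow> 'a \<Rightarrow> 'a"  (infixr \<open>*\<^sub>C\<close> 75)

class star =
  fixes star :: "'a \<Rightarrow> 'a"

class unital_cstar_algebra = real_normed_algebra + banach + monoid_mult + scaleC + star +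
  assumes scaleR_scaleC: "scaleR r x = complex_of_real r *\<^sub>C x"
    and scaleC_add_right: "c *\<^sub>C (x + y) = c *\<^sub>C x + c *\<^sub>C y"
    and scaleC_add_left: "(c + d) *\<^sub>C x = c *\<^sub>C x + d *\<^sub>C x"
    and scaleC_scaleC: "c *\<^sub>C (d *\<^sub>C x) = (c * d) *\<^sub>C x"
    and scaleC_one: "1 *\<^sub>C x = x"
    and norm_scaleC: "norm (c *\<^sub>C x) = cmod c * norm x"
    and mult_scaleC_left: "(c *\<^sub>C x) * y = c *\<^sub>C (x * y)"
    and mult_scaleC_right: "x * (c *\<^sub>C y) = c *\<^sub>C (x * y)"
    and star_add: "star (x + y) = star x + star y"
    and star_scaleC: "star (c *\<^sub>C x) = cnj c *\<^sub>C star x"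
    and star_mult: "star (x * y) = star y * star x"
    and star_star: "star (star x) = x"
    and cstar_identity: "norm (star x * x) = (norm x)\<^sup>2"

global_interpretation complex_vector:
  vector_space "scaleC :: complex \<Rightarrow> 'a \<Rightarrow> 'a::unital_cstar_algebra"
  by unfold_locales (simp_all add: scaleC_add_right scaleC_add_left scaleC_scaleC scaleC_one)

instantiation complex :: unital_cstar_algebra
begin

definition scaleC_complex_def: "c *\<^sub>C (z::complex) = c * z"
definition star_complex_def: "star (z::complex) = cnj z"

instance
  by standard
    (simp_all add: scaleC_complex_def star_complex_def scaleR_conv_of_real algebra_simps
      norm_mult power2_eq_square)

end

definition left_ideal :: "'a::unital_cstar_algebra set \<Rightarrow> bool" where
  "left_ideal I \<longleftrightarrow> complex_vector.subspace I \<and> (\<forall>x. \<forall>a\<in>I. x * a \<in> I)"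

text \<open>
  A functional on a left ideal \<open>I\<close> is represented by a function on the whole algebra of which
  only the values on \<open>I\<close> are ever used.
\<close>

definition linear_functional_on :: "'a::unital_cstar_algebra set \<Rightarrow> ('a \<Rightarrow> complex) \<Rightarrow> bool" where
  "linear_functional_on I g \<longleftrightarrow>
     (\<forall>a\<in>I. \<forall>b\<in>I. g (a + b) = g a + g b) \<and> (\<forall>c. \<forall>a\<in>I. g (c *\<^sub>C a) = c * g a)"

abbreviation linear_functional :: "('a::unital_cstar_algebra \<Rightarrow> complex) \<Rightarrow> bool" where
  "linear_functional f \<equiv> Vector_Spaces.linear scaleC (*) f"

definition positive_functional :: "('a::unital_cstar_algebra \<Rightarrow> complex) \<Rightarrow> bool" where
  "positive_functional f \<longleftrightarrow> linear_functional f \<and> (\<forall>x. f (star x * x) \<in> \<real>\<^sub>\<ge>\<^sub>0)"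

definition hermitian_functional :: "('a::unital_cstar_algebra \<Rightarrow> complex) \<Rightarrow> bool" where
  "hermitian_functional g \<longleftrightarrow> linear_functional g \<and> (\<forall>x. g (star x) = cnj (g x))"

definition symmetric_on :: "'a::unital_cstar_algebra set \<Rightarrow> ('a \<Rightarrow> complex) \<Rightarrow> bool" where
  "symmetric_on I g \<longleftrightarrow> (\<forall>a\<in>I. \<forall>b\<in>I. g (star b * a) = cnj (g (star a * b)))"

text \<open>
  Used only for positive \<open>f\<close>, whose values at elements \<open>star x * x\<close> are real, so that \<open>Re\<close>
  loses nothing.
\<close>

definition functional_bounded_on ::
    "('a::unital_cstar_algebra \<Rightarrow> complex) \<Rightarrow> 'a set \<Rightarrow> ('a \<Rightarrow> complex) \<Rightarrow> bool" where
  "functional_bounded_on f I g \<longleftrightarrow>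
     (\<exists>\<alpha>>0. \<forall>x. \<forall>a\<in>I. (cmod (g (star x * a)))\<^sup>2 \<le> \<alpha>\<^sup>2 * Re (f (star x * x)) * Re (f (star a * a)))"

end

theory Submission
  imports Defs
begin

text \<open>
  Suppose \<open>g\<close> is a continuous hermitian functional on the whole algebra. It is a difference of two
  positive functionals, and the Cauchy-Schwarz inequality for each of them bounds \<open>g\<close> by their sum.
  The decomposition comes from convexity: the positive cone is normal, that is
  \<open>norm k \<le> norm (k + l)\<close> for positive \<open>k\<close> and \<open>l\<close> (\<open>norm_le_norm_add_pos_cone\<close>), and for a normal
  cone a Hahn-Banach argument produces a positive functional above \<open>g\<close>
  (\<open>hermitian_functional_positive_majorant\<close>). The cone is defined by a norm condition that makes
  convexity evident. What is deep is that it contains every \<open>star x * x\<close>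
  (\<open>star_mult_self_in_pos_cone\<close>); this is proved with square roots and growth rates of powers
  instead of a functional calculus.

  Conversely, let \<open>g\<^sub>0\<close> be symmetric and bounded by \<open>f\<close> on \<open>I\<close>. In the Hilbert space \<open>H\<close> obtained
  from \<open>f\<close>, let \<open>P\<close> be the projection onto the closure of \<open>I\<close>, which commutes with the left
  multiplications. Boundedness writes \<open>g\<^sub>0 (star x * a)\<close> as \<open>\<langle>T a, x\<rangle>\<close> for a bounded \<open>T\<close> from the
  closure of \<open>I\<close> to \<open>H\<close> that commutes with left multiplications, and symmetry says that the
  compression of \<open>T\<close> is self-adjoint. Then \<open>S = T P + (T P)\<^sup>* - P T P\<close> is a self-adjoint extension
  of \<open>T\<close> in the commutant, and \<open>x \<mapsto> \<langle>S x, 1\<rangle>\<close> is a hermitian extension of \<open>g\<^sub>0\<close>. The proof below keeps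
  only the estimate that this yields, \<open>2 Re (g\<^sub>0 a) \<le> C * norm (a + star a)\<close> on \<open>I\<close>
  (\<open>symmetric_bounded_Re_le_norm\<close>), and derives it inside the algebra by replacing \<open>P 1\<close> with
  elements of \<open>I\<close> that nearly minimise the distance to \<open>1\<close>. The extension then follows from
  the same Hahn-Banach argument (\<open>hermitian_extension_of_Re_le_norm\<close>).

  That argument is \<open>sandwich_functional\<close>: a convex cone of lower bounds for a linear functional can be
  met by a functional of norm at most \<open>M\<close> if each single bound is compatible with this norm.
\<close>

section \<open>Norm and involution\<close>

lemma star_0 [simp]: "star (0::'a::unital_cstar_algebra) = 0"
  using star_add[of "0::'a" 0] by simp

lemma star_minus [simp]: "star (- x) = - star (x::'a::unital_cstar_algebra)"
  using star_add[of x "- x"] by (metis add.right_inverse minus_unique star_0)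

lemma star_diff: "star (x - y) = star x - star (y::'a::unital_cstar_algebra)"
  using star_add[of x "- y"] by simp

lemma star_1 [simp]: "star (1::'a::unital_cstar_algebra) = 1"
  by (metis mult.left_neutral mult.right_neutral star_mult star_star)

lemma star_scaleR [simp]: "star (r *\<^sub>R x) = r *\<^sub>R star (x::'a::unital_cstar_algebra)"
  by (simp add: scaleR_scaleC star_scaleC)

lemma star_power: "star (x ^ n) = star (x::'a::unital_cstar_algebra) ^ n"
  by (induction n) (simp_all add: star_mult power_commutes)

lemma norm_star [simp]: "norm (star x) = norm (x::'a::unital_cstar_algebra)"
proof -
  have "norm x \<le> norm (star x)" for x :: 'a
  proof (cases "norm x = 0")
    case False
    have "norm x * norm x \<le> norm (star x) * norm x"
      using cstar_identity[of x] norm_mult_ineq[of "star x" x] by (simp add: power2_eq_square)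
    then show ?thesis
      using False by simp
  qed simp
  from this[of x] this[of "star x"] show ?thesis
    by (simp add: star_star)
qed

lemma norm_one_le: "norm (1::'a::unital_cstar_algebra) \<le> 1"
proof -
  have "norm (1::'a) = norm (1::'a) ^ 2"
    using cstar_identity[of "1::'a"] by simp
  then show ?thesis
    by (auto simp: power2_eq_square)
qed

lemma norm_power_le: "norm (x ^ n) \<le> norm (x::'a::unital_cstar_algebra) ^ n"
proof (induction n)
  case 0
  show ?case using norm_one_le by simp
next
  case (Suc n)
  then show ?case
    by (simp add: order_trans[OF norm_mult_ineq mult_left_mono])
qed

lemma norm_square_selfadjoint:
  "star h = h \<Longrightarrow> norm (h * h) = (norm (h::'a::unital_cstar_algebra))\<^sup>2"
  using cstar_identity[of h] by simp

text \<open>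
  The \<open>C\<^sup>*\<close>-identity gives the exponents \<open>2 ^ m\<close> by repeated squaring; any other exponent is
  squeezed against the next power of two by submultiplicativity. This replaces every appeal to the
  spectral radius below.
\<close>
lemma norm_power_selfadjoint:
  fixes h :: "'a::unital_cstar_algebra"
  assumes "star h = h" "n > 0"
  shows "norm (h ^ n) = norm h ^ n"
proof -
  have pow2: "norm (h ^ (2 ^ m)) = norm h ^ (2 ^ m)" for m
  proof (induction m)
    case (Suc m)
    have "h ^ (2 ^ Suc m) = h ^ (2 ^ m) * h ^ (2 ^ m)"
      by (simp add: power_add mult_2)
    then show ?case
      using norm_square_selfadjoint[of "h ^ (2 ^ m)"] assms(1) Suc
      by (simp add: star_power power_mult[symmetric] mult.commute)
  qed simp
  have "norm h ^ n \<le> norm (h ^ n)"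
  proof (cases "norm h = 0")
    case True
    then show ?thesis using assms(2) by (simp add: zero_power)
  next
    case False
    have le: "n \<le> 2 ^ n"
      by simp
    have "norm h ^ n * norm h ^ (2 ^ n - n) = norm (h ^ n * h ^ (2 ^ n - n))"
      unfolding power_add[symmetric] using le pow2[of n] by simp
    also have "\<dots> \<le> norm (h ^ n) * norm h ^ (2 ^ n - n)"
      by (rule order_trans[OF norm_mult_ineq mult_left_mono[OF norm_power_le]]) simp
    finally show ?thesis
      using False by simp
  qed
  with norm_power_le[of h n] show ?thesis
    by simp
qed

lemma bounded_linear_star: "bounded_linear (star :: 'a \<Rightarrow> 'a::unital_cstar_algebra)"
  by (rule bounded_linear_intro[where K = 1]) (simp_all add: star_add)

section \<open>Square roots and the norm of a sum of squares\<close>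

text \<open>
  The binomial series of \<open>sqrt (1 - u)\<close>; its square is \<open>1 - u\<close> by Vandermonde's identity for
  \<open>1/2 + 1/2 = 1\<close>. The root is a limit of polynomials in \<open>u\<close>, so it commutes with whatever commutes
  with \<open>u\<close>; this is how roots of commuting elements are later seen to commute.
\<close>
lemma ex_sqrt_one_minus:
  fixes u :: "'a::unital_cstar_algebra"
  assumes u: "star u = u" "norm u < 1"
  obtains b where "star b = b" "b * b = 1 - u" "\<And>z. z * u = u * z \<Longrightarrow> z * b = b * z"
proof -
  define c :: "nat \<Rightarrow> real" where "c n = ((1/2) gchoose n) * (-1) ^ n" for n
  define s where "s n = c n *\<^sub>R u ^ n" for n
  have "norm (norm u) < conv_radius (\<lambda>n. (1/2::real) gchoose n)"
    using u(2) by (simp add: conv_radius_gchoose)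
  then have sr: "summable (\<lambda>n. norm (((1/2::real) gchoose n) * norm u ^ n))"
    by (rule abs_summable_in_conv_radius)
  have "norm (s n) \<le> norm (((1/2::real) gchoose n) * norm u ^ n)" for n
    using norm_power_le[of u n]
    by (simp add: s_def c_def abs_mult power_abs mult_left_mono)
  then have ns: "summable (\<lambda>n. norm (s n))"
    by (intro summable_comparison_test'[OF sr, of 0]) simp
  then have s: "summable s"
    by (rule summable_norm_cancel)
  define b where "b = (\<Sum>n. s n)"
  have "star b = (\<Sum>n. star (s n))"
    unfolding b_def by (rule bounded_linear.suminf[OF bounded_linear_star s])
  also have "\<dots> = b"
    by (simp add: b_def s_def star_power u)
  finally have "star b = b" .
  moreover have "b * b = 1 - u"
  proof -
    have coeff: "(\<Sum>i\<le>k. c i * c (k - i)) = (1 gchoose k) * (-1) ^ k" for k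
    proof -
      have "(\<Sum>i\<le>k. c i * c (k - i)) = (\<Sum>i\<le>k. ((1/2) gchoose i) * ((1/2) gchoose (k - i)) * (-1) ^ k)"
        by (rule sum.cong) (auto simp: c_def power_add[symmetric])
      then show ?thesis
        using gbinomial_Vandermonde[of "1/2::real" "1/2" k]
        by (simp add: sum_distrib_right[symmetric] atMost_atLeast0)
    qed
    have "(\<lambda>k. \<Sum>i\<le>k. s i * s (k - i)) sums (b * b)"
      unfolding b_def by (rule Cauchy_product_sums[OF ns ns])
    moreover have "(\<Sum>i\<le>k. s i * s (k - i)) = ((1 gchoose k) * (-1) ^ k) *\<^sub>R u ^ k" for k
      unfolding coeff[symmetric] scaleR_sum_left
      by (rule sum.cong) (auto simp: s_def power_add[symmetric] mult.commute)
    ultimately have "(\<lambda>k. ((1 gchoose k) * (-1) ^ k) *\<^sub>R u ^ k) sums (b * b)"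
      by simp
    moreover have "(\<lambda>k. ((1 gchoose k) * (-1) ^ k) *\<^sub>R u ^ k) sums
        (\<Sum>k\<in>{0, 1}. ((1 gchoose k) * (-1) ^ k) *\<^sub>R u ^ k)"
    proof (rule sums_finite)
      fix k :: nat
      assume "k \<notin> {0, 1}"
      then have "(1::real) gchoose k = 0"
        using binomial_gbinomial[of 1 k, where ?'a = real] by (simp add: binomial_eq_0)
      then show "((1 gchoose k) * (-1) ^ k) *\<^sub>R u ^ k = 0"
        by simp
    qed simp
    ultimately have "b * b = (\<Sum>k\<in>{0, 1}. ((1 gchoose k) * (-1) ^ k) *\<^sub>R u ^ k)"
      by (rule sums_unique2)
    then show ?thesis by simp
  qed
  moreover have "z * b = b * z" if z: "z * u = u * z" for z
  proof -
    have "z * u ^ n = u ^ n * z" for n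
      using z by (induction n) (simp_all, metis mult.assoc)
    then have "z * s n = s n * z" for n
      by (simp add: s_def)
    then show ?thesis
      unfolding b_def by (simp add: suminf_mult[OF s, symmetric] suminf_mult2[OF s])
  qed
  ultimately show thesis
    by (rule that)
qed

text \<open>
  For commuting self-adjoint \<open>c\<close> and \<open>d\<close> the element \<open>w = d + \<i> c\<close> is normal with
  \<open>star w * w = c\<^sup>2 + d\<^sup>2\<close>, and its imaginary part \<open>c\<close> has norm at most \<open>norm w\<close>.
\<close>
lemma norm_le_norm_sum_of_squares:
  fixes c d :: "'a::unital_cstar_algebra"
  assumes "star c = c" "star d = d" "c * d = d * c"
  shows "norm (c * c) \<le> norm (c * c + d * d)"
proof -
  define w where "w = d + \<i> *\<^sub>C c"
  have w': "star w = d - \<i> *\<^sub>C c"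
    using assms by (simp add: w_def star_add star_scaleC)
  have "star w * w = c * c + d * d"
    unfolding w' unfolding w_def
    by (simp add: algebra_simps mult_scaleC_left mult_scaleC_right scaleC_scaleC assms(3)
        complex_vector.scale_minus_left scaleC_one)
  then have w2: "(norm w)\<^sup>2 = norm (c * c + d * d)"
    using cstar_identity[of w] by simp
  have "w - star w = (2 * \<i>) *\<^sub>C c"
    unfolding w' unfolding w_def by (simp add: scaleC_add_left[symmetric])
  then have "2 * norm c = norm (w - star w)"
    by (simp add: norm_scaleC norm_mult)
  also have "\<dots> \<le> 2 * norm w"
    using norm_triangle_ineq4[of w "star w"] by simp
  finally have "(norm c)\<^sup>2 \<le> (norm w)\<^sup>2"
    by simp
  then show ?thesis
    using w2 norm_square_selfadjoint[OF assms(1)] by simp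
qed

section \<open>The positive cone\<close>

text \<open>
  The positive cone, described by the norm: a real number \<open>h\<close> is nonnegative exactly if it lies
  within distance \<open>t\<close> of some \<open>t \<ge> 0\<close>. In this form closure under sums is just the triangle
  inequality.
\<close>
definition pos_cone :: "'a::unital_cstar_algebra set" where
  "pos_cone = {h. star h = h \<and> (\<exists>t\<ge>0. norm (t *\<^sub>R 1 - h) \<le> t)}"

lemma pos_cone_selfadjoint: "h \<in> pos_cone \<Longrightarrow> star h = h"
  by (simp add: pos_cone_def)

lemma pos_cone_zero: "0 \<in> pos_cone"
  by (auto simp: pos_cone_def)

lemma pos_cone_add:
  assumes "h \<in> pos_cone" "k \<in> pos_cone"
  shows "h + k \<in> pos_cone"
proof -
  from assms obtain s t where "s \<ge> 0" "norm (s *\<^sub>R 1 - h) \<le> s" "t \<ge> 0" "norm (t *\<^sub>R 1 - k) \<le> t"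
    by (auto simp: pos_cone_def)
  moreover from this have "norm ((s + t) *\<^sub>R 1 - (h + k)) \<le> s + t"
    using norm_triangle_ineq[of "s *\<^sub>R 1 - h" "t *\<^sub>R 1 - k"]
    by (simp add: scaleR_add_left algebra_simps)
  ultimately show ?thesis
    using assms by (auto simp: pos_cone_def star_add intro!: exI[of _ "s + t"])
qed

lemma pos_cone_scaleR:
  assumes "h \<in> pos_cone" "r \<ge> 0"
  shows "r *\<^sub>R h \<in> pos_cone"
proof -
  from assms obtain s where s: "s \<ge> 0" "norm (s *\<^sub>R 1 - h) \<le> s"
    by (auto simp: pos_cone_def)
  have "norm ((r * s) *\<^sub>R 1 - r *\<^sub>R h) = r * norm (s *\<^sub>R 1 - h)"
    using assms(2) norm_scaleR[of r "s *\<^sub>R 1 - h"] by (simp add: scaleR_right_diff_distrib)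
  also have "\<dots> \<le> r * s"
    using s assms(2) by (simp add: mult_left_mono)
  finally show ?thesis
    using assms s by (auto simp: pos_cone_def intro!: exI[of _ "r * s"])
qed

lemma norm_minus_in_pos_cone:
  assumes "star h = h" "norm h \<le> t"
  shows "t *\<^sub>R 1 - h \<in> pos_cone"
proof -
  have "t \<ge> 0"
    using assms(2) norm_ge_zero[of h] by linarith
  then show ?thesis
    using assms by (auto simp: pos_cone_def star_diff intro!: exI[of _ t])
qed

text \<open>
  The shift by \<open>\<epsilon>\<close> moves \<open>k\<close> strictly inside the disc of convergence of the square root series.
\<close>
lemma pos_cone_sqrt:
  fixes k :: "'a::unital_cstar_algebra"
  assumes "k \<in> pos_cone" "\<epsilon> > 0"
  obtains b where "star b = b" "b * b = k + \<epsilon> *\<^sub>R 1" "\<And>z. z * k = k * z \<Longrightarrow> z * b = b * z"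
proof -
  obtain t where t: "t \<ge> 0" "norm (t *\<^sub>R 1 - k) \<le> t" and k: "star k = k"
    using assms(1) by (auto simp: pos_cone_def)
  define q where "q = t + \<epsilon>"
  have q: "q > 0"
    using t assms(2) by (simp add: q_def)
  define u where "u = (1 / q) *\<^sub>R (t *\<^sub>R 1 - k)"
  have "star u = u"
    by (simp add: u_def star_diff k)
  moreover have "norm u < 1"
    using t q assms(2) by (simp add: u_def q_def)
  ultimately obtain c where c: "star c = c" "c * c = 1 - u" "\<And>z. z * u = u * z \<Longrightarrow> z * c = c * z"
    using ex_sqrt_one_minus by blast
  show thesis
  proof (rule that[of "sqrt q *\<^sub>R c"])
    show "star (sqrt q *\<^sub>R c) = sqrt q *\<^sub>R c"
      by (simp add: c)
    have "sqrt q *\<^sub>R c * sqrt q *\<^sub>R c = q *\<^sub>R (1 - u)"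
      using q c(2) by simp
    also have "\<dots> = k + \<epsilon> *\<^sub>R 1"
      using q by (simp add: u_def scaleR_right_diff_distrib) (simp add: q_def scaleR_add_left)
    finally show "sqrt q *\<^sub>R c * sqrt q *\<^sub>R c = k + \<epsilon> *\<^sub>R 1" .
    show "z * (sqrt q *\<^sub>R c) = sqrt q *\<^sub>R c * z" if "z * k = k * z" for z
    proof -
      have "z * u = u * z"
        using that by (simp add: u_def algebra_simps)
      then show ?thesis
        using c(3) by simp
    qed
  qed
qed

text \<open>
  Scale \<open>b\<close> to a strict contraction \<open>d\<close> and write \<open>1 - d\<^sup>2 = c\<^sup>2\<close>. Then \<open>c\<^sup>2 + d\<^sup>2 = 1\<close>, so the
  preceding estimate gives \<open>norm (1 - d\<^sup>2) \<le> 1\<close>, which is positivity of \<open>d\<^sup>2\<close>.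
\<close>
lemma square_in_pos_cone:
  fixes b :: "'a::unital_cstar_algebra"
  assumes "star b = b"
  shows "b * b \<in> pos_cone"
proof -
  define t where "t = (norm b)\<^sup>2 + 1"
  have t: "t > 0"
    by (simp add: t_def add_nonneg_pos)
  define d where "d = (1 / sqrt t) *\<^sub>R b"
  have dd: "d * d = (1 / t) *\<^sub>R (b * b)"
    using t by (simp add: d_def)
  have sd: "star d = d"
    by (simp add: d_def assms)
  have "star (d * d) = d * d"
    by (simp add: sd star_mult)
  moreover have "norm (d * d) < 1"
    using t norm_square_selfadjoint[OF assms] by (simp add: dd) (simp add: t_def)
  ultimately obtain c where c: "star c = c" "c * c = 1 - d * d" "d * c = c * d"
    using ex_sqrt_one_minus by (metis mult.assoc)
  have "norm (1 - d * d) \<le> 1"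
    using norm_le_norm_sum_of_squares[OF c(1) sd c(3)[symmetric]] norm_one_le[where 'a='a] c(2) by simp
  moreover have "t *\<^sub>R 1 - b * b = t *\<^sub>R (1 - d * d)"
    using t by (simp add: dd scaleR_right_diff_distrib)
  ultimately have "norm (t *\<^sub>R 1 - b * b) \<le> t"
    using t by (simp add: mult_left_le)
  then show ?thesis
    using t assms by (auto simp: pos_cone_def star_mult intro!: exI[of _ t])
qed

text \<open>
  Normality of the cone. With \<open>t = norm (k + l)\<close>, both \<open>k\<close> and \<open>t - k = (t - (k + l)) + l\<close> are
  positive, and they commute. Up to \<open>\<epsilon>\<close> they are squares of commuting self-adjoint elements, whose
  squares add up to the scalar \<open>t\<close>.
\<close>
lemma norm_le_norm_add_pos_cone:
  fixes k l :: "'a::unital_cstar_algebra"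
  assumes "k \<in> pos_cone" "l \<in> pos_cone"
  shows "norm k \<le> norm (k + l)"
proof (rule field_le_epsilon)
  fix e :: real
  assume e: "e > 0"
  define \<epsilon> where "\<epsilon> = e / 3"
  have \<epsilon>: "\<epsilon> > 0"
    using e by (simp add: \<epsilon>_def)
  define t where "t = norm (k + l)"
  define r where "r = t *\<^sub>R 1 - k"
  have "t *\<^sub>R 1 - (k + l) \<in> pos_cone"
    using assms by (intro norm_minus_in_pos_cone) (auto simp: star_add pos_cone_selfadjoint t_def)
  from pos_cone_add[OF this assms(2)] have "r \<in> pos_cone"
    by (simp add: r_def)
  then obtain c where c: "star c = c" "c * c = r + \<epsilon> *\<^sub>R 1" "\<And>z. z * r = r * z \<Longrightarrow> z * c = c * z"
    using pos_cone_sqrt \<epsilon> by blast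
  obtain b where b: "star b = b" "b * b = k + \<epsilon> *\<^sub>R 1" "\<And>z. z * k = k * z \<Longrightarrow> z * b = b * z"
    using pos_cone_sqrt assms(1) \<epsilon> by blast
  have "k * c = c * k"
    by (rule c(3)) (simp add: r_def algebra_simps)
  then have "b * c = c * b"
    using b(3) by metis
  then have "norm (b * b) \<le> norm (b * b + c * c)"
    by (rule norm_le_norm_sum_of_squares[OF b(1) c(1)])
  also have "b * b + c * c = (t + 2 * \<epsilon>) *\<^sub>R 1"
    by (simp add: b(2) c(2) r_def scaleR_add_left flip: scaleR_2)
  also have "norm \<dots> \<le> t + 2 * \<epsilon>"
    using norm_one_le[where 'a='a] \<epsilon> by (simp add: t_def mult_left_le)
  finally have "norm (k + \<epsilon> *\<^sub>R 1) \<le> t + 2 * \<epsilon>"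
    by (simp add: b(2))
  moreover have "norm (\<epsilon> *\<^sub>R (1::'a)) \<le> \<epsilon>"
    using norm_one_le[where 'a='a] \<epsilon> by (simp add: mult_left_le)
  moreover have "norm k \<le> norm (k + \<epsilon> *\<^sub>R 1) + norm (\<epsilon> *\<^sub>R (1::'a))"
    using norm_triangle_ineq4[of "k + \<epsilon> *\<^sub>R 1" "\<epsilon> *\<^sub>R 1"] by simp
  ultimately show "norm k \<le> norm (k + l) + e"
    by (simp add: \<epsilon>_def t_def)
qed

section \<open>Positivity of \<open>star x * x\<close>\<close>

text \<open>
  A substitute for the equality of the nonzero spectra of \<open>star y * y\<close> and \<open>y * star y\<close>. With
  \<open>v = t + y * star y\<close> and \<open>w = t + star y * y\<close> one has \<open>v ^ n * y * star y = y * w ^ n * star y\<close>.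
  If \<open>norm v > s \<ge> norm w\<close>, the left-hand side \<open>v ^ n * (v - t)\<close> grows like \<open>norm v ^ n\<close>, while the
  right-hand side is at most of order \<open>s ^ n\<close>.
\<close>
lemma norm_shift_star_swap:
  fixes y :: "'a::unital_cstar_algebra"
  assumes "norm (t *\<^sub>R 1 + star y * y) \<le> s" "0 \<le> t" "t \<le> s"
  shows "norm (t *\<^sub>R 1 + y * star y) \<le> s"
proof (rule ccontr)
  define v where "v = t *\<^sub>R 1 + y * star y"
  define w where "w = t *\<^sub>R 1 + star y * y"
  assume "\<not> norm (t *\<^sub>R 1 + y * star y) \<le> s"
  then have V: "norm v > s"
    by (simp add: v_def)
  have s: "s \<ge> 0"
    using assms(1) norm_ge_zero order_trans by blast
  have sv: "star v = v"
    by (simp add: v_def star_add star_mult star_star)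
  have swap: "v ^ n * y = y * w ^ n" for n
  proof (induction n)
    case (Suc n)
    have "v * y = y * w"
      by (simp add: v_def w_def algebra_simps)
    then show ?case
      using Suc by (metis mult.assoc power_Suc)
  qed simp
  have bound: "norm v ^ n * (norm v - t) \<le> s ^ n * (norm y)\<^sup>2" if "n > 0" for n
  proof -
    have "v ^ n * v - t *\<^sub>R v ^ n = v ^ n * y * star y"
      by (simp add: v_def algebra_simps)
    also have "\<dots> = y * w ^ n * star y"
      by (simp add: swap)
    also have "norm \<dots> \<le> norm y * norm w ^ n * norm y"
    proof -
      have "norm (y * w ^ n) \<le> norm y * norm w ^ n"
        by (rule order_trans[OF norm_mult_ineq mult_left_mono[OF norm_power_le norm_ge_zero]])
      then show ?thesis
        using order_trans[OF norm_mult_ineq[of "y * w ^ n" "star y"] mult_right_mono] by simp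
    qed
    also have "\<dots> \<le> norm y * s ^ n * norm y"
      using assms(1) by (intro mult_right_mono mult_left_mono power_mono) (simp_all add: w_def)
    finally have le: "norm (v ^ n * v - t *\<^sub>R v ^ n) \<le> s ^ n * (norm y)\<^sup>2"
      by (simp add: power2_eq_square mult_ac)
    have nv: "norm (v ^ n) = norm v ^ n"
      using norm_power_selfadjoint[OF sv that] .
    have nv1: "norm (v ^ n * v) = norm v ^ n * norm v"
      using norm_power_selfadjoint[OF sv, of "Suc n"] by (simp add: power_commutes)
    show ?thesis
      using norm_triangle_ineq2[of "v ^ n * v" "t *\<^sub>R v ^ n"] le assms(2)
      by (simp add: nv nv1 algebra_simps)
  qed
  have Vt: "norm v - t > 0"
    using V assms(3) by simp
  show False
  proof (cases "s = 0")
    case True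
    then show False
      using bound[of 1] V Vt by (simp add: mult_le_0_iff)
  next
    case False
    then have s0: "s > 0"
      using s by simp
    obtain n where n: "(norm y)\<^sup>2 / (norm v - t) < (norm v / s) ^ n"
      using real_arch_pow[of "norm v / s"] V s0 by auto
    have "(norm v / s) ^ Suc n * (norm v - t) \<le> (norm y)\<^sup>2"
      using bound[of "Suc n"] s0 by (simp add: power_divide field_simps)
    then have "(norm v / s) ^ Suc n \<le> (norm y)\<^sup>2 / (norm v - t)"
      using Vt by (simp add: pos_le_divide_eq)
    moreover have "(norm v / s) ^ n \<le> (norm v / s) ^ Suc n"
      using V s0 by (intro power_increasing) auto
    ultimately show False
      using n by simp
  qed
qed

lemma one_minus_star_mult_swap:
  fixes y :: "'a::unital_cstar_algebra"
  assumes "1 - star y * y \<in> pos_cone"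
  shows "1 - y * star y \<in> pos_cone"
proof -
  obtain t where t: "t \<ge> 0" "norm (t *\<^sub>R 1 - (1 - star y * y)) \<le> t"
    using assms by (auto simp: pos_cone_def)
  have "norm (t *\<^sub>R 1 + star y * y) \<le> t + 1"
    using norm_triangle_ineq[of "t *\<^sub>R 1 - (1 - star y * y)" 1] t norm_one_le[where 'a='a] by simp
  then have "norm (t *\<^sub>R 1 + y * star y) \<le> t + 1"
    using t by (intro norm_shift_star_swap) auto
  then have "norm ((t + 1) *\<^sub>R 1 - (1 - y * star y)) \<le> t + 1"
    by (simp add: scaleR_add_left)
  then show ?thesis
    using t by (auto simp: pos_cone_def star_diff star_mult star_star intro!: exI[of _ "t + 1"])
qed

text \<open>
  If \<open>y = p + \<i> q\<close> with \<open>p\<close>, \<open>q\<close> self-adjoint, the sum is \<open>2 (p\<^sup>2 + q\<^sup>2)\<close>; the proof works with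
  \<open>2 p\<close> and \<open>- 2 q\<close>.
\<close>
lemma star_mult_sum_in_pos_cone:
  fixes y :: "'a::unital_cstar_algebra"
  shows "star y * y + y * star y \<in> pos_cone"
proof -
  define p where "p = y + star y"
  define q where "q = \<i> *\<^sub>C (y - star y)"
  have "star p = p" "star q = q"
    by (simp_all add: p_def q_def star_add star_diff star_scaleC star_star add.commute
        flip: scaleC_add_right complex_vector.scale_minus_right)
  then have "(1/2) *\<^sub>R (p * p + q * q) \<in> pos_cone"
    by (intro pos_cone_scaleR pos_cone_add square_in_pos_cone) auto
  moreover have "p * p + q * q = 2 *\<^sub>R (star y * y + y * star y)"
    by (simp add: p_def q_def mult_scaleC_left mult_scaleC_right scaleC_scaleC scaleC_one
        complex_vector.scale_minus_left algebra_simps scaleR_2)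
  ultimately show ?thesis
    by simp
qed

text \<open>
  Let \<open>a = star x * x\<close> and \<open>v = 1 - a\<close>; the aim is \<open>norm v \<le> 1\<close>. If \<open>a\<close> had a negative spectral
  value, \<open>v ^ n\<close> would blow up there, so that \<open>a v ^ n\<close> would be large and negative. But
  \<open>a v ^ n = star y * y\<close> for \<open>y = x r ^ n\<close>, where \<open>r\<^sup>2 = v\<close>. It is at most \<open>a \<le> 1\<close>, because
  \<open>a v ^ n - a v ^ (n + 1) = (a r ^ n)\<^sup>2\<close>. By the swap, \<open>y * star y \<le> 1\<close> too, and since
  \<open>star y * y + y * star y \<ge> 0\<close> this bounds \<open>star y * y\<close> from below by \<open>- 1\<close>. So \<open>a v ^ n\<close> stays
  bounded, whereas \<open>norm (v ^ (n + 1) - v ^ n)\<close> would tend to infinity if \<open>norm v > 1\<close>.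
\<close>
lemma star_mult_self_in_pos_cone_contraction:
  fixes x :: "'a::unital_cstar_algebra"
  assumes "norm x < 1"
  shows "star x * x \<in> pos_cone"
proof -
  define a where "a = star x * x"
  have sa: "star a = a"
    by (simp add: a_def star_mult star_star)
  have na: "norm a < 1"
    using assms by (simp add: a_def cstar_identity power_less_one_iff)
  obtain r where r: "star r = r" "r * r = 1 - a" "a * r = r * a"
    using ex_sqrt_one_minus[OF sa na] by metis
  have ar: "a * r ^ n = r ^ n * a" for n
    using r(3) by (induction n) (simp_all, metis mult.assoc)
  define v where "v = 1 - a"
  have sv: "star v = v"
    by (simp add: v_def star_diff sa)
  have rv: "r ^ n * r ^ n = v ^ n" for n
    unfolding v_def r(2)[symmetric] power2_eq_square[symmetric] power_mult[symmetric] power_add[symmetric]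
    by (simp add: mult_2_right mult_2)
  have av: "r ^ n * a * r ^ n = a * v ^ n" for n
    using ar[of n] rv[of n] by (metis mult.assoc)
  have le_a: "a - a * v ^ n \<in> pos_cone" for n
  proof (induction n)
    case 0
    show ?case by (simp add: pos_cone_zero)
  next
    case (Suc n)
    have "(a * r ^ n) * (a * r ^ n) = a * v ^ n - a * v ^ Suc n"
    proof -
      have "(a * r ^ n) * (a * r ^ n) = a * a * (r ^ n * r ^ n)"
        using ar[of n] by (metis mult.assoc)
      also have "\<dots> = a * ((1 - v) * v ^ n)"
        by (simp add: rv v_def mult.assoc)
      finally show ?thesis
        by (simp add: algebra_simps)
    qed
    moreover have "(a * r ^ n) * (a * r ^ n) \<in> pos_cone"
      by (rule square_in_pos_cone) (simp add: star_mult star_power sa r(1) ar)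
    ultimately show ?case
      using pos_cone_add[OF Suc] by fastforce
  qed
  have bound: "norm (a * v ^ n) \<le> 3" for n
  proof -
    define y where "y = x * r ^ n"
    have yy: "star y * y = a * v ^ n"
      unfolding av[symmetric] by (simp add: y_def a_def star_mult star_power r(1) mult.assoc)
    have "1 - a \<in> pos_cone"
      using norm_minus_in_pos_cone[OF sa, of 1] na by simp
    from pos_cone_add[OF this le_a[of n]] have 1: "1 - star y * y \<in> pos_cone"
      by (simp add: yy)
    from pos_cone_add[OF one_minus_star_mult_swap[OF 1] star_mult_sum_in_pos_cone[of y]]
    have "1 + star y * y \<in> pos_cone"
      by (simp add: add.commute)
    from norm_le_norm_add_pos_cone[OF 1 this]
    have "norm (1 - star y * y) \<le> norm (2 *\<^sub>R (1::'a))"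
      by (simp add: scaleR_2)
    then have "norm (1 - star y * y) \<le> 2"
      using norm_one_le[where 'a='a] by simp
    then show ?thesis
      using norm_triangle_ineq4[of 1 "1 - star y * y"] norm_one_le[where 'a='a] by (simp add: yy)
  qed
  have "norm v \<le> 1"
  proof (rule ccontr)
    assume V: "\<not> norm v \<le> 1"
    obtain n where n: "3 / (norm v - 1) < norm v ^ n"
      using real_arch_pow[of "norm v"] V by auto
    have "norm v ^ Suc n * (norm v - 1) = norm (v ^ Suc (Suc n)) - norm (v ^ Suc n)"
      using norm_power_selfadjoint[OF sv, of "Suc (Suc n)"] norm_power_selfadjoint[OF sv, of "Suc n"]
      by (simp add: algebra_simps)
    also have "\<dots> \<le> norm (v ^ Suc (Suc n) - v ^ Suc n)"
      by (rule norm_triangle_ineq2)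
    also have "v ^ Suc (Suc n) - v ^ Suc n = - (a * v ^ Suc n)"
      by (simp add: v_def algebra_simps)
    also have "norm \<dots> \<le> 3"
      using bound[of "Suc n"] by simp
    finally have "norm v ^ Suc n \<le> 3 / (norm v - 1)"
      using V by (simp add: pos_le_divide_eq)
    moreover have "norm v ^ n \<le> norm v ^ Suc n"
      using V by (intro power_increasing) auto
    ultimately show False
      using n by simp
  qed
  then show ?thesis
    using norm_minus_in_pos_cone[OF sv, of 1] by (simp add: v_def a_def)
qed

lemma star_mult_self_in_pos_cone: "star x * x \<in> pos_cone"
proof -
  define c where "c = norm x + 1"
  have c: "c > 0"
    by (simp add: c_def add_nonneg_pos)
  have "norm ((1 / c) *\<^sub>R x) < 1"
    using c by (simp add: c_def)
  from pos_cone_scaleR[OF star_mult_self_in_pos_cone_contraction[OF this], of "c\<^sup>2"]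
  show ?thesis
    using c by (simp add: power2_eq_square)
qed

section \<open>Linear functionals above a convex cone of constraints\<close>

text \<open>
  A form of the Hahn-Banach theorem that prescribes lower bounds \<open>f k \<ge> r\<close> for \<open>(k, r)\<close> in a
  convex cone; the norm of \<open>f\<close> is controlled as soon as the prescribed bounds respect it. Enlarge
  the cone of constraints to a maximal one \<open>C\<close> by Zorn's lemma. The largest value \<open>f x\<close> that can be
  required at \<open>x\<close> without violating the norm bound is then already required by \<open>C\<close>, by maximality.
  So \<open>f\<close> is superadditive because \<open>C\<close> is a cone, and subadditive because it is an infimum over \<open>C\<close>.
\<close>
lemma sandwich_functional:
  fixes K :: "('a::real_normed_vector \<times> real) set"
  assumes K: "convex_cone K" and M: "M \<ge> 0"
    and dom: "\<And>k r. (k, r) \<in> K \<Longrightarrow> r \<le> M * norm k"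
  obtains f where "linear f" "\<And>x. \<bar>f x\<bar> \<le> M * norm x" "\<And>k r. (k, r) \<in> K \<Longrightarrow> r \<le> f k"
proof -
  define A where "A = {C. convex_cone C \<and> K \<subseteq> C \<and> (\<forall>(k, r)\<in>C. r \<le> M * norm k)}"
  have "\<exists>C\<in>A. \<forall>D\<in>A. C \<subseteq> D \<longrightarrow> D = C"
  proof (rule subset_Zorn_nonempty)
    show "A \<noteq> {}"
      using K dom by (auto simp: A_def)
    fix \<C>
    assume ne: "\<C> \<noteq> {}" and ch: "subset.chain A \<C>"
    have sub: "\<C> \<subseteq> A" and total: "\<And>X Y. X \<in> \<C> \<Longrightarrow> Y \<in> \<C> \<Longrightarrow> X \<subseteq> Y \<or> Y \<subseteq> X"
      using ch by (auto simp: subset_chain_def)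
    have cc: "convex_cone X" if "X \<in> \<C>" for X
      using that sub by (auto simp: A_def)
    have "convex_cone (\<Union>\<C>)"
      unfolding convex_cone_iff
    proof (intro conjI ballI allI impI)
      show "0 \<in> \<Union>\<C>"
        using ne cc convex_cone_contains_0 by blast
      show "x + y \<in> \<Union>\<C>" if "x \<in> \<Union>\<C>" "y \<in> \<Union>\<C>" for x y
      proof -
        from that obtain X Y where XY: "X \<in> \<C>" "x \<in> X" "Y \<in> \<C>" "y \<in> Y"
          by blast
        then show ?thesis
          using total[of X Y] convex_cone_add[OF cc] by blast
      qed
      show "c *\<^sub>R x \<in> \<Union>\<C>" if "x \<in> \<Union>\<C>" "0 \<le> c" for x c
        using that cc convex_cone_scaleR by blast
    qed
    moreover have "K \<subseteq> \<Union>\<C>"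
      using ne sub by (auto simp: A_def)
    moreover have "\<forall>(k, r)\<in>\<Union>\<C>. r \<le> M * norm k"
      using sub by (fastforce simp: A_def)
    ultimately show "\<Union>\<C> \<in> A"
      by (simp add: A_def)
  qed
  then obtain C where CA: "C \<in> A" and max: "\<And>D. D \<in> A \<Longrightarrow> C \<subseteq> D \<Longrightarrow> D = C"
    by blast
  have C: "convex_cone C" "K \<subseteq> C" and domC: "\<And>k r. (k, r) \<in> C \<Longrightarrow> r \<le> M * norm k"
    using CA by (auto simp: A_def)
  have C0: "(0, 0) \<in> C"
    using convex_cone_contains_0[OF C(1)] by (simp add: zero_prod_def)
  have C_add: "(x + y, r + s) \<in> C" if "(x, r) \<in> C" "(y, s) \<in> C" for x y r s
    using convex_cone_add[OF C(1) that] by simp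
  have C_scale: "(t *\<^sub>R x, t * r) \<in> C" if "(x, r) \<in> C" "t \<ge> 0" for x r t
    using convex_cone_scaleR[OF C(1) that(2,1)] by simp
  define f where "f x = (INF (k, r)\<in>C. M * norm (x + k) - r)" for x
  have bdd: "bdd_below ((\<lambda>(k, r). M * norm (x + k) - r) ` C)" for x
  proof (rule bdd_belowI2[where m = "- M * norm x"], clarify)
    fix k r
    assume "(k, r) \<in> C"
    then have "r \<le> M * norm k"
      by (rule domC)
    also have "\<dots> \<le> M * (norm (x + k) + norm x)"
      using norm_triangle_ineq4[of "x + k" x] M by (intro mult_left_mono) auto
    finally show "- M * norm x \<le> M * norm (x + k) - r"
      by (simp add: algebra_simps)
  qed
  have f_le: "f x \<le> M * norm (x + k) - r" if "(k, r) \<in> C" for x k r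
    unfolding f_def using cINF_lower[OF bdd that] by simp
  have f_greatest: "c \<le> f x" if "\<And>k r. (k, r) \<in> C \<Longrightarrow> c \<le> M * norm (x + k) - r" for c x
    unfolding f_def using C0 that by (intro cINF_greatest) auto
  \<comment> \<open>the constraint \<open>(x, f x)\<close> can be added to \<open>C\<close>, so maximality of \<open>C\<close> puts it there\<close>
  have graph: "(x, f x) \<in> C" for x
  proof -
    define D where "D = {(k + t *\<^sub>R x, r + t * f x) | k r t. (k, r) \<in> C \<and> t \<ge> 0}"
    have D: "(k + t *\<^sub>R x, r + t * f x) \<in> D" if "(k, r) \<in> C" "t \<ge> 0" for k r t
      using that by (auto simp: D_def)
    have CD: "C \<subseteq> D"
    proof
      fix z assume "z \<in> C"
      then show "z \<in> D"
        using D[of "fst z" "snd z" 0] by simp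
    qed
    have "convex_cone D"
      unfolding convex_cone_iff
    proof (intro conjI ballI allI impI)
      show "0 \<in> D"
        using C0 CD by (auto simp: zero_prod_def)
      show "u + v \<in> D" if "u \<in> D" "v \<in> D" for u v
      proof -
        from that obtain k r s l q t where
          "u = (k + s *\<^sub>R x, r + s * f x)" "(k, r) \<in> C" "s \<ge> 0"
          "v = (l + t *\<^sub>R x, q + t * f x)" "(l, q) \<in> C" "t \<ge> 0"
          by (auto simp: D_def)
        then show ?thesis
          using D[OF C_add[of k r l q], of "s + t"] by (simp add: algebra_simps)
      qed
      show "c *\<^sub>R u \<in> D" if "u \<in> D" "0 \<le> c" for u c
      proof -
        from that obtain k r s where "u = (k + s *\<^sub>R x, r + s * f x)" "(k, r) \<in> C" "s \<ge> 0"
          by (auto simp: D_def)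
        then show ?thesis
          using D[OF C_scale[of k r c], of "c * s"] that(2) by (simp add: algebra_simps)
      qed
    qed
    moreover have "r + t * f x \<le> M * norm (k + t *\<^sub>R x)" if kr: "(k, r) \<in> C" and t: "t \<ge> 0" for k r t
    proof (cases "t = 0")
      case True
      then show ?thesis
        using domC[OF kr] by simp
    next
      case False
      then have "t > 0"
        using t by simp
      then have "f x \<le> M * norm (x + (1 / t) *\<^sub>R k) - (1 / t) * r"
        using C_scale[OF kr, of "1 / t"] by (intro f_le) simp
      then have "t * f x \<le> t * (M * norm (x + (1 / t) *\<^sub>R k) - (1 / t) * r)"
        using t by (rule mult_left_mono)
      also have "\<dots> = M * norm (t *\<^sub>R (x + (1 / t) *\<^sub>R k)) - r"
        using \<open>t > 0\<close> unfolding norm_scaleR by (simp add: algebra_simps)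
      also have "t *\<^sub>R (x + (1 / t) *\<^sub>R k) = k + t *\<^sub>R x"
        using \<open>t > 0\<close> by (simp add: algebra_simps)
      finally show ?thesis
        by simp
    qed
    ultimately have "D \<in> A"
      using CD C(2) by (auto simp: A_def D_def)
    then have "D = C"
      using max CD by blast
    then show ?thesis
      using D[OF C0, of 1] by simp
  qed
  have le_f: "s \<le> f x" if "(x, s) \<in> C" for x s
  proof (rule f_greatest)
    fix k r
    assume "(k, r) \<in> C"
    from domC[OF C_add[OF that this]] show "s \<le> M * norm (x + k) - r"
      by simp
  qed
  have add: "f (x + y) = f x + f y" for x y
  proof (rule antisym)
    have "f (x + y) - f x \<le> f y"
    proof (rule f_greatest)
      fix l q
      assume l: "(l, q) \<in> C"
      have "f (x + y) - (M * norm (y + l) - q) \<le> f x"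
      proof (rule f_greatest)
        fix k r
        assume k: "(k, r) \<in> C"
        have "f (x + y) \<le> M * norm ((x + k) + (y + l)) - (r + q)"
          using f_le[OF C_add[OF k l], of "x + y"] by (simp add: algebra_simps)
        also have "\<dots> \<le> M * (norm (x + k) + norm (y + l)) - (r + q)"
          using M norm_triangle_ineq by (intro diff_right_mono mult_left_mono)
        finally show "f (x + y) - (M * norm (y + l) - q) \<le> M * norm (x + k) - r"
          by (simp add: algebra_simps)
      qed
      then show "f (x + y) - f x \<le> M * norm (y + l) - q"
        by simp
    qed
    then show "f (x + y) \<le> f x + f y"
      by simp
    show "f x + f y \<le> f (x + y)"
      by (rule le_f[OF C_add[OF graph graph]])
  qed
  have f0: "f 0 = 0"
    using add[of 0 0] by simp
  have minus: "f (- x) = - f x" for x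
    using add[of x "- x"] f0 by simp
  have scale_ge: "t * f x \<le> f (t *\<^sub>R x)" if "t \<ge> 0" for t x
    by (rule le_f[OF C_scale[OF graph that]])
  have scale_pos: "f (t *\<^sub>R x) = t * f x" if "t \<ge> 0" for t x
    using scale_ge[OF that, of x] scale_ge[OF that, of "- x"] by (simp add: minus)
  have scale: "f (t *\<^sub>R x) = t * f x" for t x
    using scale_pos[of t x] scale_pos[of "- t" x] minus[of "t *\<^sub>R x"] by (cases "t \<ge> 0") auto
  show thesis
  proof (rule that[of f])
    show "linear f"
      by (rule linearI) (simp_all add: add scale)
    show "\<bar>f x\<bar> \<le> M * norm x" for x
      using domC[OF graph, of x] domC[OF graph, of "- x"] by (simp add: minus abs_le_iff)
    show "r \<le> f k" if "(k, r) \<in> K" for k r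
      using that C(2) le_f by blast
  qed
qed

section \<open>Hermitian and positive functionals\<close>

lemma linear_functional_iff:
  "linear_functional f \<longleftrightarrow>
     (\<forall>x y. f (x + y) = f x + f y) \<and> (\<forall>c x. f (c *\<^sub>C x) = c * f (x::'a::unital_cstar_algebra))"
proof -
  have "vector_space ((*) :: complex \<Rightarrow> complex \<Rightarrow> complex)"
    by unfold_locales (simp_all add: algebra_simps)
  then show ?thesis
    using complex_vector.vector_space_axioms by (auto simp: Vector_Spaces.linear_iff)
qed

lemma linear_functional_imp_linear:
  fixes f :: "'a::unital_cstar_algebra \<Rightarrow> complex"
  shows "linear_functional f \<Longrightarrow> linear f"
  by (rule linearI)
    (simp_all add: linear_functional_iff scaleR_scaleC[where 'a = 'a] scaleR_conv_of_real)

lemma linear_functional_bounded: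
  fixes f :: "'a::unital_cstar_algebra \<Rightarrow> complex"
  assumes "linear_functional f" "continuous_on UNIV f"
  obtains M where "M \<ge> 0" "\<And>x. cmod (f x) \<le> M * norm x"
proof -
  interpret linear f
    using assms(1) by (rule linear_functional_imp_linear)
  have "isCont f 0"
    using assms(2) by (simp add: continuous_on_eq_continuous_at)
  then obtain d where d: "d > 0" "\<And>x. norm x < d \<Longrightarrow> cmod (f x) < 1"
    unfolding continuous_at_eps_delta by (metis dist_0_norm dist_commute zero zero_less_one)
  show thesis
  proof (rule that[of "2 / d"])
    show "2 / d \<ge> 0"
      using d by simp
    fix x
    show "cmod (f x) \<le> 2 / d * norm x"
    proof (cases "x = 0")
      case False
      define r where "r = d / (2 * norm x)"
      have r: "r > 0"
        using d False by (simp add: r_def)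
      have "norm (r *\<^sub>R x) < d"
        using d False by (simp add: r_def)
      from d(2)[OF this] have "r * cmod (f x) < 1"
        using r by (simp add: scale)
      then show ?thesis
        using d(1) False by (simp add: r_def field_simps)
    qed (simp add: zero)
  qed
qed

text \<open>
  Put \<open>g x = \<phi> (R x) + \<i> \<phi> (J x)\<close>, where \<open>R x\<close> and \<open>J x\<close> are the self-adjoint real and imaginary
  parts of \<open>x\<close>.
\<close>
lemma hermitian_functional_from_real:
  fixes \<phi> :: "'a::unital_cstar_algebra \<Rightarrow> real"
  assumes "linear \<phi>" and bound: "\<And>x. \<bar>\<phi> x\<bar> \<le> M * norm x"
  obtains g where "hermitian_functional g" "continuous_on UNIV g"
    "\<And>h. star h = h \<Longrightarrow> g h = complex_of_real (\<phi> h)"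
proof -
  interpret linear \<phi>
    by fact
  define R where "R x = (1/2) *\<^sub>R (x + star x)" for x :: 'a
  define J where "J x = (1/2) *\<^sub>R ((- \<i>) *\<^sub>C (x - star x))" for x :: 'a
  define g where "g x = Complex (\<phi> (R x)) (\<phi> (J x))" for x
  have R_add: "R (x + y) = R x + R y" and J_add: "J (x + y) = J x + J y" for x y
    by (simp_all add: R_def J_def star_add scaleC_add_right complex_vector.scale_right_diff_distrib
        algebra_simps)
  have R_scaleR: "R (r *\<^sub>R x) = r *\<^sub>R R x" and J_scaleR: "J (r *\<^sub>R x) = r *\<^sub>R J x" for r x
    by (simp_all add: R_def J_def scaleR_scaleC star_scaleC scaleC_add_right scaleC_scaleC
        complex_vector.scale_right_diff_distrib mult_ac)
  have R_i: "R (\<i> *\<^sub>C x) = - J x" and J_i: "J (\<i> *\<^sub>C x) = R x" for x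
    by (simp_all add: R_def J_def star_scaleC scaleC_add_right scaleC_scaleC scaleC_one
        complex_vector.scale_right_diff_distrib complex_vector.scale_minus_left algebra_simps)
  have g_add: "g (x + y) = g x + g y" for x y
    by (simp add: g_def R_add J_add add complex_eq_iff)
  have g_scaleR: "g (r *\<^sub>R x) = r *\<^sub>R g x" for r x
    by (simp add: g_def R_scaleR J_scaleR scale complex_eq_iff)
  have g_i: "g (\<i> *\<^sub>C x) = \<i> * g x" for x
    by (simp add: g_def R_i J_i neg complex_eq_iff)
  have "g (c *\<^sub>C x) = c * g x" for c x
  proof -
    have "complex_of_real (Re c) + complex_of_real (Im c) * \<i> = c"
      by (simp add: complex_eq_iff)
    then have "c *\<^sub>C x = Re c *\<^sub>R x + Im c *\<^sub>R (\<i> *\<^sub>C x)"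
      by (simp add: scaleR_scaleC scaleC_scaleC flip: scaleC_add_left)
    then have "g (c *\<^sub>C x) = Re c *\<^sub>R g x + Im c *\<^sub>R (\<i> * g x)"
      by (simp only: g_add g_scaleR g_i)
    then show ?thesis
      by (simp add: complex_eq_iff)
  qed
  with g_add have "linear_functional g"
    by (simp add: linear_functional_iff)
  moreover have "g (star x) = cnj (g x)" for x
  proof -
    have "R (star x) = R x" "J (star x) = - J x"
      by (simp_all add: R_def J_def star_star add.commute complex_vector.scale_right_diff_distrib
          flip: scaleR_minus_right)
    then show ?thesis
      by (simp add: g_def neg complex_eq_iff)
  qed
  ultimately have "hermitian_functional g"
    by (simp add: hermitian_functional_def)
  moreover have "continuous_on UNIV g"
  proof -
    have nR: "norm (R x) \<le> norm x" for x
      using norm_triangle_ineq[of x "star x"] by (simp add: R_def)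
    have nJ: "norm (J x) \<le> norm x" for x
      using norm_triangle_ineq4[of x "star x"] by (simp add: J_def norm_scaleC)
    have M': "\<bar>\<phi> x\<bar> \<le> \<bar>M\<bar> * norm x" for x
      using bound[of x] by (meson abs_ge_self mult_right_mono norm_ge_zero order_trans)
    have "cmod (g x) \<le> norm x * (2 * \<bar>M\<bar>)" for x
    proof -
      have "cmod (g x) \<le> \<bar>\<phi> (R x)\<bar> + \<bar>\<phi> (J x)\<bar>"
        using cmod_le[of "g x"] by (simp add: g_def)
      also have "\<dots> \<le> \<bar>M\<bar> * norm x + \<bar>M\<bar> * norm x"
        by (intro add_mono order_trans[OF M'] mult_left_mono nR nJ) auto
      finally show ?thesis
        by (simp add: mult_ac)
    qed
    then have "bounded_linear g"
      by (intro bounded_linear_intro g_add g_scaleR)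
    then show ?thesis
      by (rule linear_continuous_on)
  qed
  moreover have "g h = complex_of_real (\<phi> h)" if "star h = h" for h
  proof -
    have "R h = h" "J h = 0"
      using that by (simp_all add: R_def J_def flip: scaleR_2)
    then show ?thesis
      by (simp add: g_def zero complex_eq_iff)
  qed
  ultimately show thesis
    by (rule that)
qed

lemma positive_functional_Re_nonneg: "positive_functional f \<Longrightarrow> Re (f (star x * x)) \<ge> 0"
  by (simp add: positive_functional_def complex_nonneg_Reals_iff)

lemma positive_functional_add:
  assumes "positive_functional f" "positive_functional g"
  shows "positive_functional (\<lambda>x. f x + g x)"
  using assms by (simp add: positive_functional_def linear_functional_iff algebra_simps
      complex_nonneg_Reals_iff)

lemma positive_functional_Cauchy_Schwarz:
  assumes f: "positive_functional f"
  shows "(cmod (f (star x * y)))\<^sup>2 \<le> Re (f (star x * x)) * Re (f (star y * y))"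
proof -
  define A B s t where "A = Re (f (star x * x))" and "B = Re (f (star y * y))"
    and "s = f (star x * y)" and "t = f (star y * x)"
  have lin: "f (u + v) = f u + f v" "f (c *\<^sub>C u) = c * f u" for u v c
    using f by (auto simp: positive_functional_def linear_functional_iff)
  have real: "Re (f (star z * z)) \<ge> 0" "Im (f (star z * z)) = 0" for z
    using f by (auto simp: positive_functional_def complex_nonneg_Reals_iff)
  have AB: "f (star x * x) = of_real A" "f (star y * y) = of_real B"
    using real by (simp_all add: A_def B_def complex_eq_iff)
  have expand: "f (star (x + c *\<^sub>C y) * (x + c *\<^sub>C y)) = A + c * s + cnj c * t + cnj c * c * B" for c
  proof -
    have "star (x + c *\<^sub>C y) * (x + c *\<^sub>C y) =
        star x * x + c *\<^sub>C (star x * y) + cnj c *\<^sub>C (star y * x) + (cnj c * c) *\<^sub>C (star y * y)"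
      by (simp add: star_add star_scaleC scaleC_add_right distrib_left distrib_right mult_scaleC_left
          mult_scaleC_right scaleC_scaleC mult.commute add_ac)
    then show ?thesis
      by (simp add: lin AB s_def t_def)
  qed
  have "t = cnj s"
    using real(2)[of "x + 1 *\<^sub>C y"] real(2)[of "x + \<i> *\<^sub>C y"]
    unfolding expand by (simp add: complex_eq_iff)
  \<comment> \<open>evaluate at \<open>x - \<tau> (cnj s) y\<close>: this phase makes the cross terms real\<close>
  have nonneg: "0 \<le> A - 2 * \<tau> * (cmod s)\<^sup>2 + \<tau>\<^sup>2 * (cmod s)\<^sup>2 * B" for \<tau> :: real
  proof -
    have eq: "A + (- \<tau> * cnj s) * s + cnj (- \<tau> * cnj s) * t + cnj (- \<tau> * cnj s) * (- \<tau> * cnj s) * B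
        = complex_of_real (A - 2 * \<tau> * (cmod s)\<^sup>2 + \<tau>\<^sup>2 * (cmod s)\<^sup>2 * B)"
      unfolding \<open>t = cnj s\<close> by (simp add: complex_eq_iff cmod_power2)
        (simp add: power2_eq_square algebra_simps)
    then show ?thesis
      using real(1)[of "x + (- \<tau> * cnj s) *\<^sub>C y"]
      by (simp only: expand eq Re_complex_of_real)
  qed
  have "(cmod s)\<^sup>2 \<le> A * B"
  proof (cases "B = 0")
    case True
    have "cmod s = 0"
    proof (rule ccontr)
      assume "cmod s \<noteq> 0"
      then show False
        using nonneg[of "(A + 1) / (cmod s)\<^sup>2"] True real(1)[of x] by (simp add: A_def)
    qed
    then show ?thesis
      by (simp add: True)
  next
    case False
    then have "B > 0"
      using real(1)[of y] by (simp add: B_def)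
    then show ?thesis
      using nonneg[of "1 / B"] by (simp add: field_simps power2_eq_square)
  qed
  then show ?thesis
    by (simp add: A_def B_def s_def)
qed

text \<open>
  Up to \<open>\<epsilon>\<close>, the positive element \<open>(norm y)\<^sup>2 - star y * y\<close> is a square \<open>b\<^sup>2\<close>, and \<open>f\<close> is
  nonnegative at \<open>star (b * z) * (b * z)\<close>.
\<close>
lemma positive_functional_mult_le:
  assumes f: "positive_functional f"
  shows "Re (f (star (y * z) * (y * z))) \<le> (norm y)\<^sup>2 * Re (f (star z * z))"
proof (rule field_le_epsilon)
  fix e :: real
  assume e: "e > 0"
  interpret linear f
    using f by (simp add: positive_functional_def linear_functional_imp_linear)
  define p where "p = Re (f (star z * z))"
  have p: "p \<ge> 0"
    using f by (simp add: p_def positive_functional_Re_nonneg)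
  define \<epsilon> where "\<epsilon> = e / (p + 1)"
  have \<epsilon>: "\<epsilon> > 0"
    using e p by (simp add: \<epsilon>_def)
  have "(norm y)\<^sup>2 *\<^sub>R 1 - star y * y \<in> pos_cone"
    by (rule norm_minus_in_pos_cone) (simp_all add: star_mult star_star cstar_identity)
  then obtain b where b: "star b = b" "b * b = (norm y)\<^sup>2 *\<^sub>R 1 - star y * y + \<epsilon> *\<^sub>R 1"
    using pos_cone_sqrt \<epsilon> by blast
  have "star (b * z) * (b * z) = star z * (b * b) * z"
    by (simp add: star_mult b(1) mult.assoc)
  also have "\<dots> = ((norm y)\<^sup>2 + \<epsilon>) *\<^sub>R (star z * z) - star (y * z) * (y * z)"
    unfolding b(2) by (simp add: star_mult algebra_simps)
  finally have "Re (f (star (b * z) * (b * z))) =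
      ((norm y)\<^sup>2 + \<epsilon>) * p - Re (f (star (y * z) * (y * z)))"
    by (simp add: diff scale p_def)
  then have "Re (f (star (y * z) * (y * z))) \<le> ((norm y)\<^sup>2 + \<epsilon>) * p"
    using positive_functional_Re_nonneg[OF f, of "b * z"] by simp
  also have "\<dots> \<le> (norm y)\<^sup>2 * p + e"
    using e p by (simp add: \<epsilon>_def field_simps)
  finally show "Re (f (star (y * z) * (y * z))) \<le> (norm y)\<^sup>2 * Re (f (star z * z)) + e"
    by (simp add: p_def)
qed

section \<open>From a hermitian functional to a positive majorant\<close>

text \<open>
  The functional is obtained from the sandwich lemma with the requirements \<open>F (k + l) \<ge> Re (g k)\<close>
  for positive \<open>k\<close> and \<open>l\<close>: the case \<open>k = 0\<close> makes \<open>F\<close> positive and the case \<open>l = 0\<close> makes \<open>F - g\<close>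
  positive. Normality of the cone is exactly the compatibility with the norm that the sandwich lemma
  asks for.
\<close>
lemma hermitian_functional_positive_majorant:
  fixes g :: "'a::unital_cstar_algebra \<Rightarrow> complex"
  assumes g: "hermitian_functional g" "continuous_on UNIV g"
  obtains F where "positive_functional F" "continuous_on UNIV F"
    "positive_functional (\<lambda>x. F x - g x)"
proof -
  have lin: "linear_functional g" and herm: "\<And>x. g (star x) = cnj (g x)"
    using g(1) by (auto simp: hermitian_functional_def)
  interpret g: linear g
    using lin by (rule linear_functional_imp_linear)
  obtain M where M: "M \<ge> 0" "\<And>x. cmod (g x) \<le> M * norm x"
    using linear_functional_bounded[OF lin g(2)] by blast
  define K where "K = {(k + l, Re (g k)) | k l. k \<in> pos_cone \<and> l \<in> pos_cone}"
  have K: "(k + l, Re (g k)) \<in> K" if "k \<in> pos_cone" "l \<in> pos_cone" for k l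
    using that by (auto simp: K_def)
  have "convex_cone K"
    unfolding convex_cone_iff
  proof (intro conjI ballI allI impI)
    show "0 \<in> K"
      using K[OF pos_cone_zero pos_cone_zero] by (simp add: zero_prod_def g.zero)
    show "u + v \<in> K" if "u \<in> K" "v \<in> K" for u v
    proof -
      from that obtain k l k' l' where
        "u = (k + l, Re (g k))" "k \<in> pos_cone" "l \<in> pos_cone"
        "v = (k' + l', Re (g k'))" "k' \<in> pos_cone" "l' \<in> pos_cone"
        by (auto simp: K_def)
      then show ?thesis
        using K[of "k + k'" "l + l'"] by (simp add: pos_cone_add g.add add_ac)
    qed
    show "c *\<^sub>R u \<in> K" if "u \<in> K" "0 \<le> c" for u c
    proof -
      from that obtain k l where "u = (k + l, Re (g k))" "k \<in> pos_cone" "l \<in> pos_cone"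
        by (auto simp: K_def)
      then show ?thesis
        using K[of "c *\<^sub>R k" "c *\<^sub>R l"] that(2) by (simp add: pos_cone_scaleR g.scale scaleR_add_right)
    qed
  qed
  moreover have "r \<le> M * norm h" if "(h, r) \<in> K" for h r
  proof -
    from that obtain k l where kl: "h = k + l" "r = Re (g k)" "k \<in> pos_cone" "l \<in> pos_cone"
      by (auto simp: K_def)
    have "r \<le> M * norm k"
      using M(2)[of k] complex_Re_le_cmod[of "g k"] by (simp add: kl)
    also have "\<dots> \<le> M * norm h"
      using norm_le_norm_add_pos_cone[OF kl(3,4)] M(1) by (simp add: kl mult_left_mono)
    finally show ?thesis .
  qed
  ultimately obtain \<phi> where \<phi>: "linear \<phi>" "\<And>x. \<bar>\<phi> x\<bar> \<le> M * norm x"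
      "\<And>h r. (h, r) \<in> K \<Longrightarrow> r \<le> \<phi> h"
    using sandwich_functional M(1) by blast
  obtain F where F: "hermitian_functional F" "continuous_on UNIV F"
      "\<And>h. star h = h \<Longrightarrow> F h = complex_of_real (\<phi> h)"
    using hermitian_functional_from_real[OF \<phi>(1,2)] by blast
  have Fx: "F (star x * x) = complex_of_real (\<phi> (star x * x))" for x
    by (intro F(3)) (simp add: star_mult star_star)
  have pos: "star x * x \<in> pos_cone" for x :: 'a
    by (rule star_mult_self_in_pos_cone)
  have Fpos: "0 \<le> \<phi> (star x * x)" for x
    using \<phi>(3)[OF K[OF pos_cone_zero pos[of x]]] by (simp add: g.zero)
  have Fg: "Re (g (star x * x)) \<le> \<phi> (star x * x)" for x
    using \<phi>(3)[OF K[OF pos[of x] pos_cone_zero]] by simp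
  have greal: "Im (g (star x * x)) = 0" for x
    using herm[of "star x * x"] by (simp add: star_mult star_star complex_eq_iff)
  show thesis
  proof (rule that)
    show "positive_functional F"
      using F(1) Fpos by (simp add: positive_functional_def hermitian_functional_def Fx)
    show "continuous_on UNIV F"
      by (rule F(2))
    have "linear_functional (\<lambda>x. F x - g x)"
      using F(1) lin by (simp add: hermitian_functional_def linear_functional_iff algebra_simps)
    moreover have "F (star x * x) - g (star x * x) \<in> \<real>\<^sub>\<ge>\<^sub>0" for x
      using Fg[of x] greal[of x] by (simp add: Fx complex_nonneg_Reals_iff)
    ultimately show "positive_functional (\<lambda>x. F x - g x)"
      by (simp add: positive_functional_def)
  qed
qed

text \<open>
  Cauchy-Schwarz for \<open>F\<close> and for \<open>G\<close>, each of which is dominated by \<open>F + G\<close>. Bounding the two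
  terms separately gives the constant 2.
\<close>
lemma functional_bounded_on_difference:
  fixes F G :: "'a::unital_cstar_algebra \<Rightarrow> complex"
  assumes F: "positive_functional F" and G: "positive_functional G"
  shows "functional_bounded_on (\<lambda>x. F x + G x) I (\<lambda>x. F x - G x)"
  unfolding functional_bounded_on_def
proof (intro exI[of _ 2] conjI allI ballI)
  fix x a :: 'a
  define P where "P y = Re (F (star y * y) + G (star y * y))" for y
  have nonneg: "Re (F (star y * y)) \<ge> 0" "Re (G (star y * y)) \<ge> 0" for y
    using F G positive_functional_Re_nonneg by auto
  have "(cmod (F (star x * a)))\<^sup>2 \<le> P x * P a"
    by (rule order_trans[OF positive_functional_Cauchy_Schwarz[OF F]], rule mult_mono)
      (use nonneg in \<open>auto simp: P_def\<close>)
  then have nF: "cmod (F (star x * a)) \<le> sqrt (P x * P a)"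
    by (rule real_le_rsqrt)
  have "(cmod (G (star x * a)))\<^sup>2 \<le> P x * P a"
    by (rule order_trans[OF positive_functional_Cauchy_Schwarz[OF G]], rule mult_mono)
      (use nonneg in \<open>auto simp: P_def\<close>)
  then have nG: "cmod (G (star x * a)) \<le> sqrt (P x * P a)"
    by (rule real_le_rsqrt)
  have "cmod (F (star x * a) - G (star x * a)) \<le> 2 * sqrt (P x * P a)"
    using norm_triangle_ineq4[of "F (star x * a)" "G (star x * a)"] nF nG by simp
  then have "(cmod (F (star x * a) - G (star x * a)))\<^sup>2 \<le> (2 * sqrt (P x * P a))\<^sup>2"
    by (rule power_mono) simp
  also have "\<dots> = 2\<^sup>2 * P x * P a"
    using nonneg by (simp add: power_mult_distrib P_def)
  finally show "(cmod (F (star x * a) - G (star x * a)))\<^sup>2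
      \<le> 2\<^sup>2 * Re (F (star x * x) + G (star x * x)) * Re (F (star a * a) + G (star a * a))"
    by (simp add: P_def)
qed simp

section \<open>From a symmetric bounded functional to a hermitian extension\<close>

text \<open>
  In the semi-inner product \<open>(x, y) \<mapsto> f (star y * x)\<close>, \<open>e\<close> is an almost best approximation of \<open>1\<close>
  by elements of \<open>I\<close>, so \<open>d = 1 - e\<close> is almost orthogonal to \<open>I\<close>. Since \<open>star a * a * d\<close> lies in
  \<open>I\<close> for \<open>a \<in> I\<close>, the number \<open>f (star (a * d) * (a * d)) = f (star d * (star a * a * d))\<close> is small.
  In the completion \<open>e\<close> tends to the projection of \<open>1\<close> onto the closure of \<open>I\<close>.
\<close>
lemma ex_near_projection_of_one:
  fixes f :: "'a::unital_cstar_algebra \<Rightarrow> complex"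
  assumes f: "positive_functional f" and I: "left_ideal I" and \<epsilon>: "0 < \<epsilon>" "\<epsilon> \<le> 1"
  obtains e where "e \<in> I" "Re (f (star (1 - e) * (1 - e))) \<le> Re (f 1) + 1"
    "\<And>a. a \<in> I \<Longrightarrow> Re (f (star (a * (1 - e)) * (a * (1 - e)))) \<le>
       \<epsilon> * (1 + (norm a) ^ 4 * (Re (f 1) + 1))"
proof -
  interpret linear f
    using f by (simp add: positive_functional_def linear_functional_imp_linear)
  have sub: "complex_vector.subspace I" and ideal: "\<And>x a. a \<in> I \<Longrightarrow> x * a \<in> I"
    using I by (auto simp: left_ideal_def)
  define N where "N z = Re (f (star z * z))" for z
  have N0: "N z \<ge> 0" for z
    using f by (simp add: N_def positive_functional_Re_nonneg)
  have Nmult: "N (y * z) \<le> (norm y)\<^sup>2 * N z" for y z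
    using positive_functional_mult_le[OF f, of y z] by (simp add: N_def)
  define \<delta> where "\<delta> = (INF e\<in>I. N (1 - e))"
  have bdd: "bdd_below ((\<lambda>e. N (1 - e)) ` I)"
    using N0 by (intro bdd_belowI2[where m = 0])
  have I0: "0 \<in> I"
    using sub by (rule complex_vector.subspace_0)
  have \<delta>_le: "\<delta> \<le> N (1 - e)" if "e \<in> I" for e
    unfolding \<delta>_def by (rule cINF_lower[OF bdd that])
  have \<delta>1: "\<delta> \<le> Re (f 1)"
    using \<delta>_le[OF I0] by (simp add: N_def)
  have "\<exists>e\<in>I. N (1 - e) < \<delta> + \<epsilon>\<^sup>2"
  proof -
    have "(INF e\<in>I. N (1 - e)) < \<delta> + \<epsilon>\<^sup>2"
      using \<epsilon> by (simp add: \<delta>_def)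
    then show ?thesis
      using cINF_less_iff[OF _ bdd] I0 by auto
  qed
  then obtain e where e: "e \<in> I" "N (1 - e) < \<delta> + \<epsilon>\<^sup>2"
    by blast
  define d where "d = 1 - e"
  have "\<epsilon>\<^sup>2 \<le> 1"
    using \<epsilon> by (simp add: power_le_one)
  then have Nd: "N d \<le> Re (f 1) + 1"
    using e(2) \<delta>1 by (simp add: d_def)
  have "N (a * d) \<le> \<epsilon> * (1 + (norm a) ^ 4 * (Re (f 1) + 1))" if a: "a \<in> I" for a
  proof -
    define b where "b = star a * a * d"
    have "a * d \<in> I"
      unfolding d_def right_diff_distrib
      using complex_vector.subspace_diff[OF sub] a ideal[OF e(1)] by simp
    then have bI: "b \<in> I"
      unfolding b_def mult.assoc by (rule ideal)
    have Nb: "N b \<le> (norm a) ^ 4 * (Re (f 1) + 1)"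
    proof -
      have "N b \<le> (norm (star a * a))\<^sup>2 * N d"
        unfolding b_def by (rule Nmult)
      also have "\<dots> = (norm a) ^ 4 * N d"
        by (simp add: cstar_identity flip: power_mult)
      also have "\<dots> \<le> (norm a) ^ 4 * (Re (f 1) + 1)"
        using Nd by (simp add: mult_left_mono)
      finally show ?thesis .
    qed
    \<comment> \<open>perturb the almost minimizer \<open>e\<close> in the direction \<open>b\<close>; the step size \<open>\<epsilon>\<close> matches
      the error \<open>\<epsilon>\<^sup>2\<close> allowed in the choice of \<open>e\<close>\<close>
    have "e + \<epsilon> *\<^sub>R b \<in> I"
      unfolding scaleR_scaleC
      by (intro complex_vector.subspace_add complex_vector.subspace_scale sub e bI)
    from \<delta>_le[OF this] have "\<delta> \<le> N (d - \<epsilon> *\<^sub>R b)"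
      by (simp add: d_def diff_diff_eq)
    also have "star (d - \<epsilon> *\<^sub>R b) * (d - \<epsilon> *\<^sub>R b) =
        star d * d - (2 * \<epsilon>) *\<^sub>R (star (a * d) * (a * d)) + \<epsilon>\<^sup>2 *\<^sub>R (star b * b)"
    proof -
      have "star d * b = star (a * d) * (a * d)" "star b * d = star (a * d) * (a * d)"
        by (simp_all add: b_def star_mult star_star mult.assoc)
      then show ?thesis
        by (simp add: star_diff algebra_simps power2_eq_square flip: scaleR_2 scaleR_scaleR)
          (simp add: mult.commute)
    qed
    then have "N (d - \<epsilon> *\<^sub>R b) = N d - 2 * \<epsilon> * N (a * d) + \<epsilon>\<^sup>2 * N b"
      by (simp add: N_def add diff scale)
    also have "\<dots> \<le> \<delta> + \<epsilon>\<^sup>2 - 2 * \<epsilon> * N (a * d) + \<epsilon>\<^sup>2 * N b"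
      using e(2) by (simp add: d_def)
    finally have "\<epsilon> * (2 * N (a * d)) \<le> \<epsilon> * (\<epsilon> * (1 + N b))"
      by (simp add: algebra_simps power2_eq_square)
    then have "2 * N (a * d) \<le> \<epsilon> * (1 + N b)"
      using \<epsilon> by simp
    also have "\<dots> \<le> \<epsilon> * (1 + (norm a) ^ 4 * (Re (f 1) + 1))"
      using Nb \<epsilon> by simp
    finally show ?thesis
      using N0[of "a * d"] by linarith
  qed
  then show thesis
    using that[OF e(1)] Nd by (simp add: N_def d_def)
qed

text \<open>
  A hermitian extension of \<open>g\<close> must take the value \<open>2 Re (g a)\<close> at \<open>a + star a\<close>; the bound says
  that this prescription is consistent and bounded. On the completion of the algebra for \<open>f\<close>, \<open>g\<close> is given by an operator on
  the closure of \<open>I\<close> that commutes with left multiplication and has a self-adjoint extension.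
  Replacing the projection of \<open>1\<close> by the approximation \<open>e\<close> turns the extended functional into
  \<open>L x = g (x * e) + cnj (g (star x * e)) - g (star e * (x * e))\<close>, which is hermitian and has norm
  at most \<open>C\<close> uniformly in \<open>e\<close>. With \<open>d = 1 - e\<close>, it satisfies
  \<open>g a - L a = g (star d * (a * d))\<close> for \<open>a \<in> I\<close> by symmetry, and this tends to 0 because
  \<open>a * d\<close> does.
\<close>
lemma symmetric_bounded_Re_le_norm:
  fixes f g :: "'a::unital_cstar_algebra \<Rightarrow> complex"
  assumes I: "left_ideal I" and lin: "linear_functional_on I g" and sym: "symmetric_on I g"
    and f: "positive_functional f" and bounded: "functional_bounded_on f I g"
  obtains C where "C \<ge> 0" "\<And>a. a \<in> I \<Longrightarrow> 2 * Re (g a) \<le> C * norm (a + star a)"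
proof -
  interpret linear f
    using f by (simp add: positive_functional_def linear_functional_imp_linear)
  have sub: "complex_vector.subspace I" and ideal: "\<And>x a. a \<in> I \<Longrightarrow> x * a \<in> I"
    using I by (auto simp: left_ideal_def)
  have g_add: "g (a + b) = g a + g b" if "a \<in> I" "b \<in> I" for a b
    using lin that by (simp add: linear_functional_on_def)
  have g_diff: "g (a - b) = g a - g b" if "a \<in> I" "b \<in> I" for a b
    using g_add[of "a - b" b] that complex_vector.subspace_diff[OF sub] by simp
  have g_sym: "g (star b * a) = cnj (g (star a * b))" if "a \<in> I" "b \<in> I" for a b
    using sym that unfolding symmetric_on_def by blast
  define s where "s z = sqrt (Re (f (star z * z)))" for z
  have Re0: "Re (f (star z * z)) \<ge> 0" for z
    using f by (rule positive_functional_Re_nonneg)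
  have s0: "s z \<ge> 0" for z
    by (simp add: s_def Re0)
  have s_mult: "s (y * z) \<le> norm y * s z" for y z
    using real_sqrt_le_mono[OF positive_functional_mult_le[OF f, of y z]]
    by (simp add: s_def real_sqrt_mult)
  obtain \<alpha> where \<alpha>: "\<alpha> > 0" and sq: "\<And>x a. a \<in> I \<Longrightarrow>
      (cmod (g (star x * a)))\<^sup>2 \<le> \<alpha>\<^sup>2 * Re (f (star x * x)) * Re (f (star a * a))"
    using bounded by (auto simp: functional_bounded_on_def)
  have g_bound: "cmod (g (star x * a)) \<le> \<alpha> * s x * s a" if "a \<in> I" for x a
    using real_le_rsqrt[OF sq[OF that, of x]] \<alpha> by (simp add: s_def real_sqrt_mult)
  define B where "B = 4 * Re (f 1) + 2"
  have f1: "Re (f 1) \<ge> 0"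
    using Re0[of 1] by simp
  define C where "C = 3 * \<alpha> * B"
  \<comment> \<open>\<open>C\<close> collects three terms, each at most \<open>\<alpha> * B\<close> times \<open>norm (a + star a)\<close>;
    \<open>B\<close> bounds \<open>f 1\<close> and \<open>f (star e * e)\<close>\<close>
  have main: "2 * Re (g a) \<le> C * norm (a + star a) +
      2 * \<alpha> * sqrt (Re (f 1) + 1) * sqrt (\<epsilon> * (1 + (norm a) ^ 4 * (Re (f 1) + 1)))"
    if a: "a \<in> I" and \<epsilon>: "0 < \<epsilon>" "\<epsilon> \<le> 1" for a \<epsilon>
  proof -
    obtain e where eI: "e \<in> I" and d: "Re (f (star (1 - e) * (1 - e))) \<le> Re (f 1) + 1"
      and ad: "Re (f (star (a * (1 - e)) * (a * (1 - e)))) \<le> \<epsilon> * (1 + (norm a) ^ 4 * (Re (f 1) + 1))"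
      using ex_near_projection_of_one[OF f I \<epsilon>] a by metis
    define x where "x = a + star a"
    have sx: "star x = x"
      by (simp add: x_def star_add star_star add.commute)
    have e: "(s e)\<^sup>2 \<le> B"
    proof -
      have "star e * e + star (2 *\<^sub>R 1 - e) * (2 *\<^sub>R 1 - e) = 2 *\<^sub>R 1 + 2 *\<^sub>R (star (1 - e) * (1 - e))"
        by (simp add: star_diff star_add algebra_simps scaleR_2)
      then have "Re (f (star e * e)) + Re (f (star (2 *\<^sub>R 1 - e) * (2 *\<^sub>R 1 - e))) =
          2 * Re (f 1) + 2 * Re (f (star (1 - e) * (1 - e)))"
        by (metis add scale plus_complex.sel(1) scaleR_complex.sel(1))
      then show ?thesis
        using d Re0[of "2 *\<^sub>R 1 - e"] Re0[of e] by (simp add: s_def B_def)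
    qed
    have "(s 1)\<^sup>2 \<le> B"
      using f1 by (simp add: s_def B_def)
    with e have "s 1 \<le> sqrt B" "s e \<le> sqrt B"
      by (auto intro: real_le_rsqrt)
    then have "s 1 * s e \<le> sqrt B * sqrt B"
      using s0 by (intro mult_mono) (auto simp: B_def f1)
    then have s1e: "s 1 * s e \<le> B"
      using f1 by (simp add: B_def)
    have xe: "\<bar>Re (g (x * e))\<bar> \<le> \<alpha> * B * norm x"
    proof -
      have "\<bar>Re (g (x * e))\<bar> \<le> cmod (g (star x * e))"
        using abs_Re_le_cmod[of "g (x * e)"] by (simp add: sx)
      also have "\<dots> \<le> \<alpha> * s x * s e"
        by (rule g_bound[OF eI])
      also have "\<dots> \<le> \<alpha> * (norm x * s 1) * s e"
        using s_mult[of x 1] \<alpha> s0 by (intro mult_right_mono mult_left_mono) auto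
      also have "\<dots> = \<alpha> * norm x * (s 1 * s e)"
        by simp
      also have "\<dots> \<le> \<alpha> * norm x * B"
        using \<alpha> s1e by (intro mult_left_mono) auto
      finally show ?thesis
        by (simp add: mult_ac)
    qed
    have exe: "\<bar>Re (g (star e * (x * e)))\<bar> \<le> \<alpha> * B * norm x"
    proof -
      have "\<bar>Re (g (star e * (x * e)))\<bar> \<le> cmod (g (star (x * e) * e))"
        using abs_Re_le_cmod[of "g (star e * (x * e))"] by (simp add: star_mult sx mult.assoc)
      also have "\<dots> \<le> \<alpha> * s (x * e) * s e"
        by (rule g_bound[OF eI])
      also have "\<dots> \<le> \<alpha> * (norm x * s e) * s e"
        using s_mult[of x e] \<alpha> s0 by (intro mult_right_mono mult_left_mono) auto
      also have "\<dots> = \<alpha> * norm x * (s e)\<^sup>2"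
        by (simp add: power2_eq_square)
      also have "\<dots> \<le> \<alpha> * norm x * B"
        using \<alpha> e by (intro mult_left_mono) auto
      finally show ?thesis
        by (simp add: mult_ac)
    qed
    define d where "d = 1 - e"
    have adI: "a * d \<in> I"
      using complex_vector.subspace_diff[OF sub a ideal[OF eI, of a]] by (simp add: d_def right_diff_distrib)
    have "cmod (g (star d * (a * d))) \<le> \<alpha> * s d * s (a * d)"
      by (rule g_bound[OF adI])
    also have "\<dots> \<le> \<alpha> * sqrt (Re (f 1) + 1) * sqrt (\<epsilon> * (1 + (norm a) ^ 4 * (Re (f 1) + 1)))"
      using \<alpha> d ad Re0 f1 unfolding s_def d_def by (intro mult_mono real_sqrt_le_mono) auto
    finally have dad: "Re (g (star d * (a * d))) \<le>
        \<alpha> * sqrt (Re (f 1) + 1) * sqrt (\<epsilon> * (1 + (norm a) ^ 4 * (Re (f 1) + 1)))"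
      using complex_Re_le_cmod[of "g (star d * (a * d))"] by linarith
    \<comment> \<open>for self-adjoint \<open>x\<close> the real part of \<open>L x\<close> is \<open>2 * Re (g (x * e)) - Re (g (star e * (x * e)))\<close>\<close>
    have "2 * Re (g a) = 2 * Re (g (x * e)) - Re (g (star e * (x * e))) + 2 * Re (g (star d * (a * d)))"
    proof -
      have mem: "y * e \<in> I" "y * (z * e) \<in> I" "y * a \<in> I" for y z
        using ideal[OF eI] ideal[OF a] by (simp_all add: ideal)
      have "star d * (a * d) = (a - a * e) - (star e * a - star e * (a * e))"
        by (simp add: d_def star_diff algebra_simps)
      then have gd: "g (star d * (a * d)) = (g a - g (a * e)) - (g (star e * a) - g (star e * (a * e)))"
        using a mem complex_vector.subspace_diff[OF sub] by (simp add: g_diff)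
      have gx: "g (x * e) = g (a * e) + g (star a * e)"
        by (simp add: x_def distrib_right g_add mem)
      have gex: "g (star e * (x * e)) = g (star e * (a * e)) + g (star e * (star a * e))"
        by (simp add: x_def distrib_right distrib_left g_add mem)
      have sym1: "g (star a * e) = cnj (g (star e * a))"
        by (rule g_sym[OF eI a])
      have sym2: "g (star e * (star a * e)) = cnj (g (star e * (a * e)))"
        using g_sym[OF eI mem(1)[of a]] by (simp add: star_mult mult.assoc)
      show ?thesis
        by (simp add: gd gx gex sym1 sym2)
    qed
    then show ?thesis
      using xe exe dad by (simp add: C_def x_def[symmetric] abs_le_iff)
  qed
  have "2 * Re (g a) \<le> C * norm (a + star a)" if a: "a \<in> I" for a
  proof (rule LIMSEQ_le_const)
    let ?\<kappa> = "1 + (norm a) ^ 4 * (Re (f 1) + 1)"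
    show "\<exists>N. \<forall>n\<ge>N. 2 * Re (g a) \<le> C * norm (a + star a) +
        2 * \<alpha> * sqrt (Re (f 1) + 1) * sqrt (inverse (real (Suc n)) * ?\<kappa>)"
      by (intro exI[of _ 0] allI impI main[OF a]) (simp_all add: inverse_le_1_iff)
    have "(\<lambda>n. C * norm (a + star a) +
        2 * \<alpha> * sqrt (Re (f 1) + 1) * sqrt (inverse (real (Suc n)) * ?\<kappa>)) \<longlonglongrightarrow>
        C * norm (a + star a) + 2 * \<alpha> * sqrt (Re (f 1) + 1) * sqrt (0 * ?\<kappa>)"
      by (intro tendsto_intros LIMSEQ_inverse_real_of_nat)
    then show "(\<lambda>n. C * norm (a + star a) +
        2 * \<alpha> * sqrt (Re (f 1) + 1) * sqrt (inverse (real (Suc n)) * ?\<kappa>)) \<longlonglongrightarrow>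
        C * norm (a + star a)"
      by simp
  qed
  moreover have "C \<ge> 0"
    using \<alpha> f1 by (simp add: C_def B_def)
  ultimately show thesis
    using that by blast
qed

text \<open>
  The sandwich lemma is applied to the constraints \<open>\<phi> (a + star a) \<ge> 2 Re (g a)\<close>; replacing \<open>a\<close> by
  \<open>- a\<close> turns them into equalities, and replacing \<open>a\<close> by \<open>\<i> a\<close> recovers the imaginary part of \<open>g\<close>.
\<close>
lemma hermitian_extension_of_Re_le_norm:
  fixes g :: "'a::unital_cstar_algebra \<Rightarrow> complex"
  assumes sub: "complex_vector.subspace I" and lin: "linear_functional_on I g" and C: "C \<ge> 0"
    and le: "\<And>a. a \<in> I \<Longrightarrow> 2 * Re (g a) \<le> C * norm (a + star a)"
  obtains G where "hermitian_functional G" "continuous_on UNIV G" "\<And>a. a \<in> I \<Longrightarrow> G a = g a"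
proof -
  have g_add: "g (a + b) = g a + g b" if "a \<in> I" "b \<in> I" for a b
    using lin that by (simp add: linear_functional_on_def)
  have g_scale: "g (c *\<^sub>C a) = c * g a" if "a \<in> I" for c a
    using lin that by (simp add: linear_functional_on_def)
  have I_scale: "c *\<^sub>C a \<in> I" if "a \<in> I" for c a
    using complex_vector.subspace_scale[OF sub that] .
  define K where "K = {(a + star a, 2 * Re (g a)) | a. a \<in> I}"
  have K: "(a + star a, 2 * Re (g a)) \<in> K" if "a \<in> I" for a
    using that by (auto simp: K_def)
  have "convex_cone K"
    unfolding convex_cone_iff
  proof (intro conjI ballI allI impI)
    have I0: "0 \<in> I"
      by (rule complex_vector.subspace_0[OF sub])
    then have "g 0 = 0"
      using g_scale[of 0 0] by simp
    then show "0 \<in> K"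
      using K[OF I0] by (simp add: zero_prod_def)
    show "u + v \<in> K" if "u \<in> K" "v \<in> K" for u v
    proof -
      from that obtain a b where
        "u = (a + star a, 2 * Re (g a))" "a \<in> I" "v = (b + star b, 2 * Re (g b))" "b \<in> I"
        by (auto simp: K_def)
      then show ?thesis
        using K[of "a + b"] complex_vector.subspace_add[OF sub, of a b]
        by (simp add: g_add star_add algebra_simps)
    qed
    show "c *\<^sub>R u \<in> K" if "u \<in> K" "0 \<le> c" for u c
    proof -
      from that obtain a where "u = (a + star a, 2 * Re (g a))" "a \<in> I"
        by (auto simp: K_def)
      then show ?thesis
        using K[OF I_scale, of a "complex_of_real c"]
        by (simp add: g_scale scaleR_scaleC star_scaleC scaleC_add_right mult_ac)
    qed
  qed
  moreover have "r \<le> C * norm h" if "(h, r) \<in> K" for h r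
    using that le by (auto simp: K_def)
  ultimately obtain \<phi> where \<phi>: "linear \<phi>" "\<And>x. \<bar>\<phi> x\<bar> \<le> C * norm x"
      "\<And>h r. (h, r) \<in> K \<Longrightarrow> r \<le> \<phi> h"
    using sandwich_functional C by blast
  interpret \<phi>: linear \<phi>
    by (rule \<phi>(1))
  obtain G where G: "hermitian_functional G" "continuous_on UNIV G"
      "\<And>h. star h = h \<Longrightarrow> G h = complex_of_real (\<phi> h)"
    using hermitian_functional_from_real[OF \<phi>(1,2)] by blast
  have G_add: "G (x + y) = G x + G y" and G_scale: "G (c *\<^sub>C x) = c * G x"
    and G_star: "G (star x) = cnj (G x)" for x y c
    using G(1) by (auto simp: hermitian_functional_def linear_functional_iff)
  have Re_eq: "Re (G a) = Re (g a)" if a: "a \<in> I" for a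
  proof -
    have "\<phi> (a + star a) \<ge> 2 * Re (g a)"
      by (rule \<phi>(3)[OF K[OF a]])
    moreover have "\<phi> (- (a + star a)) \<ge> - (2 * Re (g a))"
      using \<phi>(3)[OF K[OF I_scale[OF a, of "-1"]]]
      unfolding g_scale[OF a] by (simp add: complex_vector.scale_minus_left scaleC_one)
    ultimately have "\<phi> (a + star a) = 2 * Re (g a)"
      unfolding \<phi>.neg by simp
    moreover have "G (a + star a) = complex_of_real (\<phi> (a + star a))"
      by (rule G(3)) (simp add: star_add star_star add.commute)
    ultimately show ?thesis
      by (simp add: G_add G_star complex_eq_iff)
  qed
  have "G a = g a" if a: "a \<in> I" for a
    using Re_eq[OF a] Re_eq[OF I_scale[OF a, of "\<i>"]]
    by (simp add: G_scale g_scale[OF a] complex_eq_iff)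
  then show thesis
    using that G(1,2) by blast
qed

section \<open>Characterisation of the extendable functionals\<close>

theorem corollary4p2:
  fixes I :: "'a::unital_cstar_algebra set" and g\<^sub>0 :: "'a \<Rightarrow> complex"
  assumes "left_ideal I" and "linear_functional_on I g\<^sub>0"
  shows "(\<exists>g. hermitian_functional g \<and> continuous_on UNIV g \<and> (\<forall>a\<in>I. g a = g\<^sub>0 a)) \<longleftrightarrow>
    symmetric_on I g\<^sub>0 \<and>
    (\<exists>f. positive_functional f \<and> continuous_on UNIV f \<and> functional_bounded_on f I g\<^sub>0)"
proof (intro iffI conjI)
  assume "\<exists>g. hermitian_functional g \<and> continuous_on UNIV g \<and> (\<forall>a\<in>I. g a = g\<^sub>0 a)"
  then obtain g where g: "hermitian_functional g" "continuous_on UNIV g" "\<And>a. a \<in> I \<Longrightarrow> g a = g\<^sub>0 a"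
    by blast
  have ideal: "x * a \<in> I" if "a \<in> I" for x a
    using assms(1) that by (simp add: left_ideal_def)
  show "symmetric_on I g\<^sub>0"
    unfolding symmetric_on_def
  proof (intro ballI)
    fix a b
    assume "a \<in> I" "b \<in> I"
    moreover have "g (star (star a * b)) = cnj (g (star a * b))"
      using g(1) by (simp only: hermitian_functional_def)
    ultimately show "g\<^sub>0 (star b * a) = cnj (g\<^sub>0 (star a * b))"
      by (simp add: star_mult star_star g(3) ideal)
  qed
  obtain F where F: "positive_functional F" "continuous_on UNIV F"
      and G: "positive_functional (\<lambda>x. F x - g x)"
    using hermitian_functional_positive_majorant[OF g(1,2)] by blast
  define f where "f x = F x + (F x - g x)" for x
  have "positive_functional f"
    unfolding f_def by (rule positive_functional_add[OF F(1) G])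
  moreover have "continuous_on UNIV f"
    unfolding f_def by (intro continuous_intros F(2) g(2))
  moreover have "functional_bounded_on f I g\<^sub>0"
    using functional_bounded_on_difference[OF F(1) G, of I]
    by (simp add: functional_bounded_on_def f_def g(3) ideal)
  ultimately show "\<exists>f. positive_functional f \<and> continuous_on UNIV f \<and> functional_bounded_on f I g\<^sub>0"
    by blast
next
  assume "symmetric_on I g\<^sub>0 \<and>
    (\<exists>f. positive_functional f \<and> continuous_on UNIV f \<and> functional_bounded_on f I g\<^sub>0)"
  then obtain C where "C \<ge> 0" "\<And>a. a \<in> I \<Longrightarrow> 2 * Re (g\<^sub>0 a) \<le> C * norm (a + star a)"
    using symmetric_bounded_Re_le_norm[OF assms] by blast
  then show "\<exists>g. hermitian_functional g \<and> continuous_on UNIV g \<and> (\<forall>a\<in>I. g a = g\<^sub>0 a)"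
    using hermitian_extension_of_Re_le_norm[OF _ assms(2)] assms(1)
    unfolding left_ideal_def by metis
qed

end
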